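(* For any disk $D\subset\mathbb{R}^n$ there exists a constant $c_5>0$ such that, for every compact hypersurface $Z\subset D$ of class $C^1$ with $\rho(Z)>0$, we have $$b(Z)\leq c_5\left(1+\frac{1}{\rho(Z)}\right)^n.$$
   Context: A disk is a closed Euclidean ball of positive radius. $b(Z)$ is the sum of the Betti numbers of $Z$. The reach of a $C^1$ hypersurface $Z\subset\mathbb{R}^n$ is $$\rho(Z)=\sup\left\{t>0:\ \text{for all } x\in\mathbb{R}^n,\ \mathrm{dist}(x,Z)<t\implies\exists!\,z\in Z \text{ with } \mathrm{dist}(x,Z)=\mathrm{dist}(x,z)\right\}.$$ *)

theory Defs
  imports "HOL-Analysis.Analysis" "HOL-Homology.Homology"
begin

section \<open>Betti numbers\<close>

text \<open>A finite subset of an abelian group (written multiplicatively, as in HOL-Algebra)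
  that is linearly independent over the integers.\<close>

definition int_independent :: "('a, 'b) monoid_scheme \<Rightarrow> 'a set \<Rightarrow> bool" where
  "int_independent G S \<longleftrightarrow>
     finite S \<and> S \<subseteq> carrier G \<and>
     (\<forall>k :: 'a \<Rightarrow> int.
        finprod G (\<lambda>x. x [^]\<^bsub>G\<^esub> k x) S = \<one>\<^bsub>G\<^esub> \<longrightarrow> (\<forall>x\<in>S. k x = 0))"

definition abelian_rank :: "('a, 'b) monoid_scheme \<Rightarrow> enat" where
  "abelian_rank G = (SUP S \<in> {S. int_independent G S}. enat (card S))"

definition betti_number :: "nat \<Rightarrow> 'a::topological_space set \<Rightarrow> enat" where
  "betti_number p Z = abelian_rank (homology_group (int p) (top_of_set Z))"

text \<open>Infinite values are kept, so a bound on the total also asserts that it is finite.\<close>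

definition total_betti :: "'a::topological_space set \<Rightarrow> enat" where
  "total_betti Z = suminf (\<lambda>p. betti_number p Z)"


section \<open>Hypersurfaces and reach\<close>

text \<open>Embedded submanifolds of codimension one, without boundary, given locally as regular
  zero sets. Here \<open>g\<close> is the gradient of the local equation \<open>f\<close>, so its continuity says that
  \<open>f\<close> is of class \<open>C\<^sup>1\<close>.\<close>

definition C1_hypersurface :: "'a::euclidean_space set \<Rightarrow> bool" where
  "C1_hypersurface Z \<longleftrightarrow>
     (\<forall>z\<in>Z. \<exists>U (f :: 'a \<Rightarrow> real) g.
        open U \<and> z \<in> U \<and>
        (\<forall>x\<in>U. GDERIV f x :> g x) \<and> continuous_on U g \<and>
        (\<forall>x\<in>U. g x \<noteq> 0) \<and>
        Z \<inter> U = {x \<in> U. f x = 0})"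

text \<open>The reach is extended-valued: it is infinite, for instance, for a single point of the
  line. The guard \<open>Z \<noteq> {}\<close> is needed because \<open>infdist x {}\<close> is \<open>0\<close>; with it, the distance to
  the empty set behaves as \<open>\<infinity>\<close>.\<close>

definition reach :: "'a::metric_space set \<Rightarrow> ennreal" where
  "reach Z = (SUP t \<in> {t::real. t > 0 \<and>
     (\<forall>x. Z \<noteq> {} \<and> infdist x Z < t \<longrightarrow> (\<exists>!z. z \<in> Z \<and> infdist x Z = dist x z))}. ennreal t)"

end

theory Submission
  imports Defs
begin

text \<open>If every point at distance less than \<open>t\<close> from \<open>Z\<close> has a unique nearest point in \<open>Z\<close>, then
  \<open>Z\<close> is a retract of that open tube, hence of every union \<open>K \<supseteq> Z\<close> of grid boxes contained in the
  tube, and so the Betti numbers of \<open>Z\<close> are at most those of \<open>K\<close>. Boxes of mesh comparable to \<open>t\<close>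
  will do, and about \<open>(1 + 1/t)\<^sup>n\<close> of them meet the disk. Adding the open convex boxes one at a
  time, the Mayer-Vietoris inequality (from the long exact sequence and excision) increases the total
  Betti number by a bounded amount, because each box meets at most \<open>3\<^sup>n\<close> others.\<close>

subsection \<open>Rank of abelian groups\<close>

lemma finprod_hom:
  assumes "comm_group G" "comm_group H" "h \<in> hom G H" "finite I" "v \<in> I \<rightarrow> carrier G"
  shows "h (finprod G v I) = finprod H (\<lambda>i. h (v i)) I"
proof -
  interpret G: comm_group G by fact
  interpret H: comm_group H by fact
  interpret h: group_hom G H h
    using assms(3) by unfold_locales
  show ?thesis
    using assms(4,5) by (induction I rule: finite_induct) (auto simp: Pi_iff)
qed

text \<open>Substituting combinations into a combination multiplies the coefficient matrix by the
  coefficient vector. Used to turn a relation among the elements \<open>b s\<close> in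
  \<open>abelian_rank_exact_le\<close> into one among the elements of \<open>S\<close>.\<close>

lemma finprod_int_pow_combination:
  assumes "comm_group G" "finite I" "finite J" "v \<in> I \<rightarrow> carrier G"
  shows "finprod G (\<lambda>j. finprod G (\<lambda>i. v i [^]\<^bsub>G\<^esub> (c j i :: int)) I [^]\<^bsub>G\<^esub> (k j :: int)) J
       = finprod G (\<lambda>i. v i [^]\<^bsub>G\<^esub> (\<Sum>j\<in>J. c j i * k j)) I"
proof -
  interpret G: comm_group G by fact
  have pow: "finprod G (\<lambda>i. v i [^]\<^bsub>G\<^esub> (l i :: int)) I [^]\<^bsub>G\<^esub> (m :: int)
       = finprod G (\<lambda>i. v i [^]\<^bsub>G\<^esub> (l i * m)) I" for l m
    using assms(2,4)
  proof (induction I rule: finite_induct)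
    case (insert i I)
    then show ?case
      by (simp add: Pi_iff G.int_pow_distrib G.int_pow_pow)
  qed simp
  show ?thesis
    using assms(3)
  proof (induction J rule: finite_induct)
    case empty
    then show ?case by (simp add: G.finprod_one_eqI)
  next
    case (insert j J)
    have "finprod G (\<lambda>i. v i [^]\<^bsub>G\<^esub> (c j i * k j + (\<Sum>j\<in>J. c j i * k j))) I
        = finprod G (\<lambda>i. v i [^]\<^bsub>G\<^esub> (c j i * k j) \<otimes>\<^bsub>G\<^esub> v i [^]\<^bsub>G\<^esub> (\<Sum>j\<in>J. c j i * k j)) I"
      using assms(4) by (intro G.finprod_cong) (auto simp: G.int_pow_mult Pi_iff simp_implies_def)
    then show ?case
      using insert assms(4) by (simp add: Pi_iff pow)
  qed
qed

text \<open>Indexed, unlike \<open>int_independent\<close>, so that independence of images or of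
  chosen lifts can be stated before these are known to be distinct.\<close>

definition independent_family :: "('a, 'b) monoid_scheme \<Rightarrow> ('i \<Rightarrow> 'a) \<Rightarrow> 'i set \<Rightarrow> bool" where
  "independent_family G v I \<longleftrightarrow>
     (\<forall>k::'i \<Rightarrow> int. finprod G (\<lambda>i. v i [^]\<^bsub>G\<^esub> k i) I = \<one>\<^bsub>G\<^esub> \<longrightarrow> (\<forall>i\<in>I. k i = 0))"

lemma independent_familyD:
  "\<lbrakk>independent_family G v I; finprod G (\<lambda>i. v i [^]\<^bsub>G\<^esub> (k i :: int)) I = \<one>\<^bsub>G\<^esub>; i \<in> I\<rbrakk> \<Longrightarrow> k i = 0"
  by (auto simp: independent_family_def)

text \<open>Independence forces the family to be injective, so its range is an independent set with
  as many elements as the index set.\<close>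

lemma card_le_abelian_rank:
  assumes "comm_group G" "finite I" "v \<in> I \<rightarrow> carrier G" and ind: "independent_family G v I"
  shows "enat (card I) \<le> abelian_rank G"
proof -
  interpret G: comm_group G by fact
  have inj: "inj_on v I"
  proof (rule inj_onI, rule ccontr)
    fix i j assume ij: "i \<in> I" "j \<in> I" "v i = v j" "i \<noteq> j"
    \<comment> \<open>A repeated value would give the nontrivial relation with coefficients 1 and
      -1.\<close>
    define k :: "_ \<Rightarrow> int" where "k = (\<lambda>x. if x = i then 1 else if x = j then -1 else 0)"
    have "finprod G (\<lambda>i. v i [^]\<^bsub>G\<^esub> k i) I = finprod G (\<lambda>i. v i [^]\<^bsub>G\<^esub> k i) {i, j}"
      by (rule G.finprod_mono_neutral_cong_right) (use assms(2,3) ij in \<open>auto simp: k_def\<close>)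
    also have "\<dots> = \<one>\<^bsub>G\<^esub>"
      using ij assms(3) by (auto simp: k_def Pi_iff G.int_pow_neg)
    finally show False
      using independent_familyD [OF ind _ ij(1), of k] by (simp add: k_def)
  qed
  have "int_independent G (v ` I)"
    unfolding int_independent_def
  proof (intro conjI allI impI)
    fix k :: "_ \<Rightarrow> int"
    assume "finprod G (\<lambda>x. x [^]\<^bsub>G\<^esub> k x) (v ` I) = \<one>\<^bsub>G\<^esub>"
    moreover have "finprod G (\<lambda>x. x [^]\<^bsub>G\<^esub> k x) (v ` I) = finprod G (\<lambda>i. v i [^]\<^bsub>G\<^esub> k (v i)) I"
      using assms(3) inj by (subst G.finprod_reindex) auto
    ultimately show "\<forall>x\<in>v ` I. k x = 0"
      using independent_familyD [OF ind, of "\<lambda>i. k (v i)"] by auto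
  qed (use assms in auto)
  then show ?thesis
    unfolding abelian_rank_def by (metis SUP_upper mem_Collect_eq card_image inj)
qed

text \<open>Given independent \<open>S\<close>, choose \<open>T \<subseteq> S\<close> maximal with independent image in \<open>C\<close>. By maximality
  every \<open>s \<in> S - T\<close> yields a relation in \<open>C\<close>, that is, a combination of \<open>insert s T\<close> with nonzero
  coefficient at \<open>s\<close> that lifts to \<open>A\<close>; these lifts are independent.\<close>

lemma abelian_rank_exact_le:
  assumes cA: "comm_group A" and cB: "comm_group B" and cC: "comm_group C"
    and f: "f \<in> hom A B" and g: "g \<in> hom B C"
    and exact: "kernel B C g \<subseteq> f ` carrier A"
  shows "abelian_rank B \<le> abelian_rank A + abelian_rank C"
proof -
  interpret A: comm_group A by fact
  interpret B: comm_group B by fact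
  interpret C: comm_group C by fact
  interpret f: group_hom A B f using f by unfold_locales
  interpret g: group_hom B C g using g by unfold_locales
  have "enat (card S) \<le> abelian_rank A + abelian_rank C" if S: "int_independent B S" for S
  proof -
    have fin: "finite S" and SB: "S \<subseteq> carrier B" using S by (auto simp: int_independent_def)
    define \<F> where "\<F> = {T. T \<subseteq> S \<and> independent_family C g T}"
    have "finite \<F>" "{} \<in> \<F>"
      using fin by (auto simp: \<F>_def independent_family_def)
    then obtain T where "T \<in> \<F>" and T_max: "\<forall>T'\<in>\<F>. T \<subseteq> T' \<longrightarrow> T = T'"
      by (meson finite_has_maximal2)
    then have T: "T \<subseteq> S" "independent_family C g T"
      by (simp_all add: \<F>_def)
    have finT: "finite T" using T(1) fin finite_subset by blast
    have "\<exists>k::_ \<Rightarrow> int. k s \<noteq> 0 \<and> (\<forall>x. x \<notin> insert s T \<longrightarrow> k x = 0) \<and>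
            g (finprod B (\<lambda>x. x [^]\<^bsub>B\<^esub> k x) S) = \<one>\<^bsub>C\<^esub>" if s: "s \<in> S - T" for s
    proof -
      have "\<not> independent_family C g (insert s T)"
        using bspec [OF T_max, of "insert s T"] T(1) s by (auto simp: \<F>_def)
      then obtain k0 :: "_ \<Rightarrow> int" and x0
        where k0: "finprod C (\<lambda>x. g x [^]\<^bsub>C\<^esub> k0 x) (insert s T) = \<one>\<^bsub>C\<^esub>" "x0 \<in> insert s T" "k0 x0 \<noteq> 0"
        by (auto simp: independent_family_def)
      have gc: "g x \<in> carrier C" if "x \<in> S" for x using that SB by auto
      \<comment> \<open>Otherwise the relation would involve \<open>T\<close> alone, whose image is
        independent, so all its coefficients would vanish.\<close>
      have "k0 s \<noteq> 0"
      proof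
        assume "k0 s = 0"
        moreover have "finprod C (\<lambda>x. g x [^]\<^bsub>C\<^esub> k0 x) (insert s T)
            = g s [^]\<^bsub>C\<^esub> k0 s \<otimes>\<^bsub>C\<^esub> finprod C (\<lambda>x. g x [^]\<^bsub>C\<^esub> k0 x) T"
          by (rule C.finprod_insert) (use finT s gc T(1) in auto)
        moreover have "finprod C (\<lambda>x. g x [^]\<^bsub>C\<^esub> k0 x) T \<in> carrier C"
          by (rule C.finprod_closed) (use gc T(1) in auto)
        ultimately have "finprod C (\<lambda>x. g x [^]\<^bsub>C\<^esub> k0 x) T = \<one>\<^bsub>C\<^esub>"
          using k0(1) by simp
        then show False
          using independent_familyD [OF T(2)] k0(2,3) \<open>k0 s = 0\<close> by auto
      qed
      \<comment> \<open>Extension by zero writes every such relation over the common index set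
        \<open>S\<close>.\<close>
      define k where "k = (\<lambda>x. if x \<in> insert s T then k0 x else 0)"
      have "g (finprod B (\<lambda>x. x [^]\<^bsub>B\<^esub> k x) S) = finprod C (\<lambda>x. g (x [^]\<^bsub>B\<^esub> k x)) S"
        using SB by (intro finprod_hom [OF cB cC g fin]) auto
      also have "\<dots> = finprod C (\<lambda>x. g x [^]\<^bsub>C\<^esub> k0 x) (insert s T)"
        by (rule C.finprod_mono_neutral_cong_right)
           (use fin s T(1) SB in \<open>auto simp: k_def g.hom_int_pow subset_iff\<close>)
      finally show ?thesis
        using k0(1) \<open>k0 s \<noteq> 0\<close> by (intro exI [of _ k]) (auto simp: k_def)
    qed
    then obtain K :: "_ \<Rightarrow> _ \<Rightarrow> int" where K: "\<And>s. s \<in> S - T \<Longrightarrow> K s s \<noteq> 0"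
        "\<And>s x. s \<in> S - T \<Longrightarrow> x \<notin> insert s T \<Longrightarrow> K s x = 0"
        "\<And>s. s \<in> S - T \<Longrightarrow> g (finprod B (\<lambda>x. x [^]\<^bsub>B\<^esub> K s x) S) = \<one>\<^bsub>C\<^esub>"
      by metis
    define b where "b s = finprod B (\<lambda>x. x [^]\<^bsub>B\<^esub> K s x) S" for s
    have bB: "b s \<in> carrier B" for s
      using SB unfolding b_def by (intro B.finprod_closed) auto
    have "\<forall>s\<in>S - T. \<exists>a. a \<in> carrier A \<and> f a = b s"
    proof
      fix s assume "s \<in> S - T"
      then have "b s \<in> kernel B C g"
        using K(3) [folded b_def] bB by (simp add: kernel_def)
      then show "\<exists>a. a \<in> carrier A \<and> f a = b s"
        using exact by (metis (no_types) imageE subsetD)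
    qed
    then obtain a where a: "\<And>s. s \<in> S - T \<Longrightarrow> a s \<in> carrier A" "\<And>s. s \<in> S - T \<Longrightarrow> f (a s) = b s"
      by metis
    have "independent_family A a (S - T)"
      unfolding independent_family_def
    proof (intro allI impI ballI)
      fix k :: "_ \<Rightarrow> int" and s
      assume k: "finprod A (\<lambda>s. a s [^]\<^bsub>A\<^esub> k s) (S - T) = \<one>\<^bsub>A\<^esub>" and s: "s \<in> S - T"
      \<comment> \<open>A relation among the lifts \<open>a s\<close> is pushed forward by
        \<open>f\<close> and expanded over \<open>S\<close>, where independence of \<open>S\<close>
        applies.\<close>
      have "finprod B (\<lambda>x. x [^]\<^bsub>B\<^esub> (\<Sum>s\<in>S-T. K s x * k s)) S
          = finprod B (\<lambda>s. b s [^]\<^bsub>B\<^esub> k s) (S - T)"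
        unfolding b_def using fin SB by (subst finprod_int_pow_combination [OF cB]) auto
      also have "\<dots> = finprod B (\<lambda>s. f (a s [^]\<^bsub>A\<^esub> k s)) (S - T)"
        using a bB by (intro B.finprod_cong') (auto simp: f.hom_int_pow)
      also have "\<dots> = f (finprod A (\<lambda>s. a s [^]\<^bsub>A\<^esub> k s) (S - T))"
        using a fin by (intro finprod_hom [OF cA cB f, symmetric]) auto
      finally have "finprod B (\<lambda>x. x [^]\<^bsub>B\<^esub> (\<Sum>s\<in>S-T. K s x * k s)) S = \<one>\<^bsub>B\<^esub>"
        using k by simp
      then have "(\<Sum>s'\<in>S-T. K s' s * k s') = 0"
        using S s unfolding int_independent_def by fastforce
      \<comment> \<open>Since \<open>s\<close> lies outside \<open>T\<close>, only
        \<open>K s\<close> itself can be nonzero at \<open>s\<close>: restricted to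
        \<open>S - T\<close>, the coefficient matrix is diagonal, with nonzero diagonal
        entries.\<close>
      moreover have "(\<Sum>s'\<in>S-T. K s' s * k s') = (\<Sum>s'\<in>{s}. K s' s * k s')"
        by (rule sum.mono_neutral_right) (use fin s K(2) in auto)
      ultimately show "k s = 0"
        using K(1) s by simp
    qed
    then have "enat (card (S - T)) \<le> abelian_rank A"
      using card_le_abelian_rank [OF cA, of "S - T" a] fin a by auto
    moreover have "enat (card T) \<le> abelian_rank C"
      by (rule card_le_abelian_rank [OF cC finT _ T(2)]) (use T(1) SB in auto)
    moreover have "card S = card (S - T) + card T"
      using T(1) fin finT by (metis card_Diff_subset card_mono le_add_diff_inverse2)
    ultimately show ?thesis
      by (metis add_mono plus_enat_simps(1))
  qed
  then show ?thesis
    unfolding abelian_rank_def [of B] by (intro SUP_least) auto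
qed

lemma abelian_rank_trivial:
  assumes "comm_group G" "trivial_group G"
  shows "abelian_rank G = 0"
proof -
  interpret comm_group G by fact
  have "card S = 0" if S: "int_independent G S" for S
  proof -
    have "S = {}"
    proof (rule ccontr)
      assume "S \<noteq> {}"
      then obtain x where x: "x \<in> S" by blast
      have "finprod G (\<lambda>x. x [^]\<^bsub>G\<^esub> (1::int)) S = \<one>\<^bsub>G\<^esub>"
        using S assms(2) by (intro finprod_one_eqI) (auto simp: int_independent_def trivial_group_def)
      moreover have "finprod G (\<lambda>x. x [^]\<^bsub>G\<^esub> k x) S = \<one>\<^bsub>G\<^esub> \<Longrightarrow> k x = 0" for k :: "_ \<Rightarrow> int"
        using S x unfolding int_independent_def by blast
      from this [of "\<lambda>_. 1"] have "finprod G (\<lambda>x. x [^]\<^bsub>G\<^esub> (1::int)) S \<noteq> \<one>\<^bsub>G\<^esub>"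
        by auto
      ultimately show False by contradiction
    qed
    then show ?thesis by simp
  qed
  then have "abelian_rank G \<le> 0"
    unfolding abelian_rank_def by (intro SUP_least) (simp add: zero_enat_def)
  then show ?thesis by simp
qed

text \<open>An injective map is exactness at \<open>G\<close> of a sequence that begins with the
  trivial group, and that group has rank 0.\<close>

lemma abelian_rank_mon_le:
  assumes "comm_group G" "comm_group H" "h \<in> mon G H"
  shows "abelian_rank G \<le> abelian_rank H"
proof -
  interpret G: comm_group G by fact
  interpret H: comm_group H by fact
  let ?T = "singleton_group \<one>\<^bsub>G\<^esub>"
  have T: "comm_group ?T" "trivial_group ?T"
    by simp_all
  have h: "h \<in> hom G H" "inj_on h (carrier G)" using assms(3) by (auto simp: mon_def)
  interpret h: group_hom G H h using h(1) by unfold_locales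
  have "(\<lambda>x. x) \<in> hom ?T G" by (auto simp: hom_def singleton_group_def)
  moreover have "kernel G H h \<subseteq> (\<lambda>x. x) ` carrier ?T"
    using inj_onD [OF h(2), of _ "\<one>\<^bsub>G\<^esub>"] by (auto simp: kernel_def)
  ultimately have "abelian_rank G \<le> abelian_rank ?T + abelian_rank H"
    by (rule abelian_rank_exact_le [OF T(1) assms(1,2) _ h(1)])
  then show ?thesis
    by (simp add: abelian_rank_trivial [OF T])
qed

lemma abelian_rank_integer_group_le: "abelian_rank integer_group \<le> 1"
proof -
  interpret Z: comm_group integer_group by (rule abelian_integer_group)
  have "card S \<le> 1" if S: "int_independent integer_group S" for S
  proof (rule ccontr)
    assume "\<not> card S \<le> 1"
    moreover have fin: "finite S" using S by (auto simp: int_independent_def)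
    ultimately obtain a b where ab: "a \<in> S" "b \<in> S" "a \<noteq> b"
      by (metis One_nat_def card_le_Suc0_iff_eq)
    have *: "finprod integer_group (\<lambda>x. x [^]\<^bsub>integer_group\<^esub> k x) S = \<one>\<^bsub>integer_group\<^esub> \<Longrightarrow> k a = 0 \<and> k b = 0" for k :: "int \<Rightarrow> int"
      using S ab unfolding int_independent_def by blast
    \<comment> \<open>Two distinct integers always satisfy the relation
      \<open>a * b - b * a = 0\<close>, which is nontrivial because they are not both zero.\<close>
    define k where "k = (\<lambda>x. if x = a then b else if x = b then -a else 0)"
    have "finprod integer_group (\<lambda>x. x [^]\<^bsub>integer_group\<^esub> k x) S = finprod integer_group (\<lambda>x. x [^]\<^bsub>integer_group\<^esub> k x) {a, b}"
      by (rule Z.finprod_mono_neutral_cong_right) (use fin ab in \<open>auto simp: k_def\<close>)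
    also have "\<dots> = \<one>\<^bsub>integer_group\<^esub>"
      using ab by (subst Z.finprod_insert) (auto simp: k_def)
    finally show False
      using * [of k] ab by (simp add: k_def)
  qed
  then show ?thesis
    unfolding abelian_rank_def by (intro SUP_least) (simp add: one_enat_def)
qed

subsection \<open>Betti numbers of finite unions of convex open sets\<close>

lemma iso_imp_mon: "h \<in> iso G H \<Longrightarrow> h \<in> mon G H"
  by (simp add: iso_def mon_def bij_betw_def)

lemma betti_number_mon_le:
  assumes "h \<in> mon (homology_group (int p) (top_of_set S)) (homology_group (int p) (top_of_set T))"
  shows "betti_number p S \<le> betti_number p T"
  unfolding betti_number_def using assms by (intro abelian_rank_mon_le) simp_all

text \<open>Three rank estimates are chained: the exact sequence of the pair (\<open>X\<close>,
  \<open>A\<close>), excision of \<open>A - B\<close> to replace that pair by (\<open>B\<close>,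
  \<open>A \<inter> B\<close>), and the exact sequence of the latter, whose boundary map lowers the
  degree by one.\<close>

lemma betti_number_Un_le:
  assumes "open A" "open B"
  shows "betti_number p (A \<union> B) \<le> betti_number p A + betti_number p B +
           (if p = 0 then 0 else betti_number (p - 1) (A \<inter> B))"
proof -
  define X where "X = top_of_set (A \<union> B)"
  let ?rel = "relative_homology_group (int p)"
  have XA: "subtopology X A = top_of_set A" and XB: "subtopology X B = top_of_set B"
    by (simp_all add: X_def subtopology_subtopology Int_absorb1)
  have openA: "openin X A" and openB: "openin X B"
    using assms by (auto simp: X_def openin_open)
  have 1: "abelian_rank (homology_group (int p) X)
      \<le> abelian_rank (homology_group (int p) (subtopology X A)) + abelian_rank (?rel X A)"
    using homology_exactness_axiom_3 [of "int p" X A]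
    by (intro abelian_rank_exact_le) (auto simp: group_hom_def group_hom_axioms_def)
  have 2: "abelian_rank (?rel X A) \<le> abelian_rank (?rel (top_of_set B) (A \<inter> B))"
  proof -
    \<comment> \<open>Excision asks that the closure of the removed set lie in the interior of
      \<open>A\<close>. Here \<open>A - B\<close> is closed in \<open>X\<close>, as the complement
      of \<open>B\<close>, and \<open>A\<close> is open.\<close>
    have "closedin X (topspace X - B)"
      using openB by (simp add: closedin_diff)
    moreover have "topspace X - B = A - B"
      by (auto simp: X_def)
    ultimately have "X closure_of (A - B) \<subseteq> X interior_of A"
      using openA by (simp add: closure_of_closedin interior_of_openin)
    from homology_excision_axiom [OF this, of "A \<union> B" "int p"]
    have "hom_induced (int p) (subtopology X (A \<union> B - (A - B))) (A - (A - B)) (subtopology X (A \<union> B)) A id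
      \<in> iso (?rel (subtopology X (A \<union> B - (A - B))) (A - (A - B))) (?rel (subtopology X (A \<union> B)) A)"
      by simp
    moreover have "A \<union> B - (A - B) = B" "A - (A - B) = A \<inter> B" "subtopology X (A \<union> B) = X"
      by (auto simp: X_def subtopology_subtopology)
    ultimately have "hom_induced (int p) (top_of_set B) (A \<inter> B) X A id
        \<in> iso (?rel (top_of_set B) (A \<inter> B)) (?rel X A)"
      by (simp add: XB)
    \<comment> \<open>The excision isomorphism points towards \<open>X\<close>; its inverse gives
      the inequality in the required direction.\<close>
    then have "inv_into (carrier (?rel (top_of_set B) (A \<inter> B))) (hom_induced (int p) (top_of_set B) (A \<inter> B) X A id)
        \<in> mon (?rel X A) (?rel (top_of_set B) (A \<inter> B))"
      using group.iso_set_sym [OF group_relative_homology_group] by (blast intro: iso_imp_mon)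
    then show ?thesis
      by (intro abelian_rank_mon_le) simp_all
  qed
  have 3: "abelian_rank (?rel (top_of_set B) (A \<inter> B))
      \<le> abelian_rank (homology_group (int p) (top_of_set B))
        + abelian_rank (homology_group (int p - 1) (top_of_set (A \<inter> B)))"
  proof -
    have "subtopology (top_of_set B) (A \<inter> B) = top_of_set (A \<inter> B)"
      by (simp add: subtopology_subtopology Int_absorb1)
    with homology_exactness_axiom_1 [of "int p" "top_of_set B" "A \<inter> B"] show ?thesis
      by (intro abelian_rank_exact_le) (auto simp: group_hom_def group_hom_axioms_def)
  qed
  \<comment> \<open>In degree 0 the boundary map lands in degree -1, where homology is trivial. The
    case split is essential because \<open>p - 1\<close> on naturals would give 0 there.\<close>
  have "abelian_rank (homology_group (int p - 1) (top_of_set (A \<inter> B)))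
      = (if p = 0 then 0 else betti_number (p - 1) (A \<inter> B))"
    by (auto simp: betti_number_def abelian_rank_trivial of_nat_diff)
  with order_trans [OF 1 add_left_mono [OF order_trans [OF 2 3]]] show ?thesis
    by (simp add: betti_number_def X_def XA [unfolded X_def] add.assoc)
qed

section \<open>Total Betti numbers of unions, retracts and contractible sets\<close>

lemma total_betti_leI:
  assumes "\<And>n. (\<Sum>p<n. betti_number p Z) \<le> x"
  shows "total_betti Z \<le> x"
  unfolding total_betti_def using assms by (intro suminf_le_const) auto

lemma sum_betti_number_le_total: "(\<Sum>p<n. betti_number p Z) \<le> total_betti Z"
  unfolding total_betti_def by (intro sum_le_suminf) auto

lemma total_betti_Un_le:
  assumes "open A" "open B"
  shows "total_betti (A \<union> B) \<le> total_betti A + total_betti B + total_betti (A \<inter> B)"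
proof (rule total_betti_leI)
  fix n
  \<comment> \<open>The shift in degree merely drops the last term of the partial sum.\<close>
  have "(\<Sum>p<n. if p = 0 then 0 else betti_number (p - 1) (A \<inter> B)) \<le> (\<Sum>p<n. betti_number p (A \<inter> B))"
  proof (cases n)
    case (Suc m)
    have "(\<Sum>p<Suc m. if p = 0 then 0 else betti_number (p - 1) (A \<inter> B)) = (\<Sum>p<m. betti_number p (A \<inter> B))"
      by (subst sum.lessThan_Suc_shift) simp
    then show ?thesis
      by (simp add: Suc)
  qed simp
  have "(\<Sum>p<n. betti_number p (A \<union> B)) \<le> (\<Sum>p<n. betti_number p A + betti_number p B +
           (if p = 0 then 0 else betti_number (p - 1) (A \<inter> B)))"
    by (intro sum_mono betti_number_Un_le assms)
  also have "\<dots> \<le> (\<Sum>p<n. betti_number p A) + (\<Sum>p<n. betti_number p B) + (\<Sum>p<n. betti_number p (A \<inter> B))"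
    unfolding sum.distrib by (intro add_left_mono) fact
  also have "\<dots> \<le> total_betti A + total_betti B + total_betti (A \<inter> B)"
    by (intro add_mono sum_betti_number_le_total)
  finally show "(\<Sum>p<n. betti_number p (A \<union> B)) \<le> \<dots>" .
qed

text \<open>The retraction is a left inverse of the inclusion, so the inclusion is injective on
  homology in every degree.\<close>

lemma total_betti_retract_le:
  assumes "Z retract_of K"
  shows "total_betti Z \<le> total_betti K"
proof -
  obtain r where r: "retraction K Z r"
    using assms by (auto simp: retract_of_def)
  then have "retraction_maps (top_of_set K) (top_of_set Z) r id"
    by (auto simp: retraction_maps_def retraction_def continuous_map_in_subtopology)
  then have "section_map (top_of_set Z) (top_of_set K) id"
    by (auto simp: section_map_def)
  then have "betti_number p Z \<le> betti_number p K" for p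
    by (rule betti_number_mon_le [OF mon_hom_induced_section_map])
  then show ?thesis
    unfolding total_betti_def by (intro suminf_le) auto
qed

lemma total_betti_empty [simp]: "total_betti {} = 0"
  by (simp add: total_betti_def betti_number_def abelian_rank_trivial trivial_homology_group_empty)

text \<open>Reduced homology vanishes, so only degree 0 can contribute, and there the group is
  infinite cyclic unless \<open>S\<close> is empty.\<close>

lemma total_betti_contractible_le:
  fixes S :: "'a::real_normed_vector set"
  assumes "contractible S"
  shows "total_betti S \<le> 1"
proof (cases "S = {}")
  case False
  have X: "contractible_space (top_of_set S)"
    using assms by simp
  have "betti_number p S = 0" if "p \<noteq> 0" for p
  proof -
    have "trivial_group (homology_group (int p) (top_of_set S))"
      using trivial_reduced_homology_group_contractible_space [OF X, of "int p"] that
      by (simp add: un_reduced_homology_group)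
    then show ?thesis
      by (simp add: betti_number_def abelian_rank_trivial)
  qed
  then have "total_betti S = betti_number 0 S"
    unfolding total_betti_def using suminf_finite [of "{0}" "\<lambda>p. betti_number p S"] by auto
  also have "\<dots> \<le> abelian_rank integer_group"
  proof -
    have "homology_group 0 (top_of_set S) \<cong> integer_group"
      using contractible_imp_path_connected_space [OF X] False
      by (intro isomorphic_integer_zeroth_homology_group) auto
    then obtain h where "h \<in> iso (homology_group 0 (top_of_set S)) integer_group"
      by (auto simp: is_iso_def)
    then show ?thesis
      unfolding betti_number_def of_nat_0
      by (intro abelian_rank_mon_le [OF abelian_homology_group abelian_integer_group] iso_imp_mon)
  qed
  also have "\<dots> \<le> 1" by (rule abelian_rank_integer_group_le)
  finally show ?thesis .
qed simp

section \<open>Counting bounds for unions of convex open sets\<close>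

text \<open>The intersection of the old union with a new set \<open>B j\<close> is again a union of
  \<open>card I\<close> convex open sets, so each new set at most doubles the bound. The summand 1
  absorbs the contribution of \<open>B j\<close> itself and makes the induction close.\<close>

lemma total_betti_UN_convex:
  fixes B :: "'i \<Rightarrow> 'a::real_normed_vector set"
  assumes "finite I" "\<And>i. i \<in> I \<Longrightarrow> open (B i)" "\<And>i. i \<in> I \<Longrightarrow> convex (B i)"
  shows "total_betti (\<Union>i\<in>I. B i) + 1 \<le> enat (2 ^ card I)"
  using assms
\<comment> \<open>The family must vary: the induction hypothesis is also applied to the sets
  \<open>B i \<inter> B j\<close>.\<close>
proof (induction I arbitrary: B rule: finite_induct)
  case (insert j I)
  let ?U = "\<Union>i\<in>I. B i" and ?V = "\<Union>i\<in>I. B i \<inter> B j"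
  have Bj: "total_betti (B j) \<le> 1"
    using insert.prems by (intro total_betti_contractible_le convex_imp_contractible) auto
  have "(\<Union>i\<in>insert j I. B i) = ?U \<union> B j" "?U \<inter> B j = ?V"
    by auto
  then have "total_betti (\<Union>i\<in>insert j I. B i) \<le> total_betti ?U + total_betti (B j) + total_betti ?V"
    using total_betti_Un_le [of ?U "B j"] insert.prems(1) by (simp add: open_UN)
  also have "\<dots> \<le> total_betti ?U + 1 + total_betti ?V"
    using Bj by (intro add_mono) auto
  finally have "total_betti (\<Union>i\<in>insert j I. B i) + 1 \<le> total_betti ?U + 1 + total_betti ?V + 1"
    by (rule add_right_mono)
  also have "\<dots> = (total_betti ?U + 1) + (total_betti ?V + 1)"
    by (simp add: add_ac)
  also have "\<dots> \<le> enat (2 ^ card I) + enat (2 ^ card I)"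
    using insert.prems by (intro add_mono insert.IH) (auto intro: convex_Int)
  finally show ?case
    using insert.hyps by (simp add: mult_2)
qed (simp add: one_enat_def)

text \<open>The exponential bound is applied only to the sets that meet the new one. Each step then
  adds at most \<open>1 + (2 ^ m - 1)\<close>, and the total is linear in
  \<open>card I\<close>.\<close>

lemma total_betti_UN_sparse_le:
  fixes B :: "'i \<Rightarrow> 'a::real_normed_vector set"
  assumes "finite I" "\<And>i. i \<in> I \<Longrightarrow> open (B i)" "\<And>i. i \<in> I \<Longrightarrow> convex (B i)"
    and "\<And>j. j \<in> I \<Longrightarrow> card {i \<in> I. B i \<inter> B j \<noteq> {}} \<le> m"
  shows "total_betti (\<Union>i\<in>I. B i) \<le> enat (card I * 2 ^ m)"
  using assms
proof (induction I rule: finite_induct)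
  case (insert j I)
  let ?U = "\<Union>i\<in>I. B i"
  define J where "J = {i \<in> I. B i \<inter> B j \<noteq> {}}"
  let ?V = "\<Union>i\<in>J. B i \<inter> B j"
  have card_le: "card {i \<in> I. B i \<inter> B k \<noteq> {}} \<le> m" if "k \<in> insert j I" for k
    using card_mono [of "{i \<in> insert j I. B i \<inter> B k \<noteq> {}}" "{i \<in> I. B i \<inter> B k \<noteq> {}}"]
      insert.prems(3) [OF that] insert.hyps(1) by fastforce
  have IH: "total_betti ?U \<le> enat (card I * 2 ^ m)"
    using insert.prems card_le by (intro insert.IH) auto
  have "total_betti ?V + 1 \<le> enat (2 ^ card J)"
    by (rule total_betti_UN_convex) (use insert in \<open>auto simp: J_def intro: convex_Int\<close>)
  also have "\<dots> \<le> enat (2 ^ m)"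
    using card_le [of j] by (simp add: J_def)
  finally have V: "total_betti ?V + 1 \<le> enat (2 ^ m)" .
  have Bj: "total_betti (B j) \<le> 1"
    using insert.prems by (intro total_betti_contractible_le convex_imp_contractible) auto
  have "(\<Union>i\<in>insert j I. B i) = ?U \<union> B j" "?U \<inter> B j = ?V"
    by (auto simp: J_def)
  then have "total_betti (\<Union>i\<in>insert j I. B i) \<le> total_betti ?U + total_betti (B j) + total_betti ?V"
    using total_betti_Un_le [of ?U "B j"] insert.prems(1) by (simp add: open_UN)
  also have "\<dots> \<le> total_betti ?U + 1 + total_betti ?V"
    using Bj by (intro add_mono) auto
  also have "\<dots> = total_betti ?U + (total_betti ?V + 1)"
    by (simp add: add_ac)
  also have "\<dots> \<le> enat (card I * 2 ^ m) + enat (2 ^ m)"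
    by (intro add_mono IH V)
  finally show ?case
    using insert.hyps by (simp add: algebra_simps)
qed (simp add: zero_enat_def)

subsection \<open>The nearest-point retraction\<close>

text \<open>The nearest-point map is continuous by the closed graph theorem for maps into a compact
  space: by uniqueness, its graph is cut out of \<open>U \<times> Z\<close> by an equation between
  continuous functions.\<close>

lemma nearest_point_retract:
  fixes Z :: "'a::euclidean_space set"
  assumes "compact Z" "Z \<noteq> {}" "t > 0"
    and unique: "\<And>x. infdist x Z < t \<Longrightarrow> \<exists>!z. z \<in> Z \<and> infdist x Z = dist x z"
  shows "Z retract_of {x. infdist x Z < t}"
proof -
  define U where "U = {x. infdist x Z < t}"
  define r where "r x = (THE z. z \<in> Z \<and> infdist x Z = dist x z)" for x
  have r: "r x \<in> Z \<and> infdist x Z = dist x (r x)" if "x \<in> U" for x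
    using theI' [OF unique, of x] that by (simp add: U_def r_def)
  have r_eq: "r x = z" if "x \<in> U" "z \<in> Z" "infdist x Z = dist x z" for x z
    using unique [of x] r [OF that(1)] that by (auto simp: U_def)
  have "continuous_on U r"
  proof -
    have "closed {p. infdist (fst p) Z = dist (fst p) (snd p)}"
      by (intro closed_Collect_eq continuous_intros)
    moreover have "(\<lambda>x. (x, r x)) ` U = (U \<times> Z) \<inter> {p. infdist (fst p) Z = dist (fst p) (snd p)}"
      using r r_eq by force
    ultimately have "closedin (top_of_set (U \<times> Z)) ((\<lambda>x. (x, r x)) ` U)"
      by (simp add: closedin_closed_Int)
    moreover have "r \<in> U \<rightarrow> Z"
      using r by auto
    ultimately show ?thesis
      using continuous_closed_graph_eq [OF \<open>compact Z\<close>] by blast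
  qed
  moreover have "Z \<subseteq> U" "\<And>x. x \<in> Z \<Longrightarrow> r x = x"
    using \<open>t > 0\<close> r_eq by (auto simp: U_def)
  ultimately have "retraction U Z r"
    using r by (auto simp: retraction_def)
  then show ?thesis
    unfolding U_def retract_of_def by blast
qed

subsection \<open>Grid boxes\<close>

text \<open>The box is centred at the lattice point \<open>e * k\<close> and has half-width
  \<open>e\<close>, so neighbouring boxes overlap and the open boxes cover the whole space.\<close>

definition grid_box :: "real \<Rightarrow> int ^ 'n \<Rightarrow> (real ^ 'n) set" where
  "grid_box e k = box (\<chi> i. e * (k $ i - 1)) (\<chi> i. e * (k $ i + 1))"

lemma mem_grid_box: "x \<in> grid_box e k \<longleftrightarrow> (\<forall>i. \<bar>x $ i - e * k $ i\<bar> < e)"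
  unfolding grid_box_def mem_box_cart by (intro arg_cong [where f = All] ext) (auto simp: algebra_simps)

lemma ex_grid_box: "e > 0 \<Longrightarrow> \<exists>k. x \<in> grid_box e k"
proof
  assume e: "e > 0"
  have "e * \<lfloor>x $ i / e\<rfloor> \<le> x $ i \<and> x $ i < e * (\<lfloor>x $ i / e\<rfloor> + 1)" for i
    using floor_divide_lower [OF e, of "x $ i"] floor_divide_upper [OF e, of "x $ i"]
    by (simp add: mult.commute)
  then have "0 \<le> x $ i - e * \<lfloor>x $ i / e\<rfloor> \<and> x $ i - e * \<lfloor>x $ i / e\<rfloor> < e" for i
    by (simp add: algebra_simps)
  then have "\<bar>x $ i - e * \<lfloor>x $ i / e\<rfloor>\<bar> < e" for i
    by (simp add: abs_of_nonneg)
  then show "x \<in> grid_box e (\<chi> i. \<lfloor>x $ i / e\<rfloor>)"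
    by (simp add: mem_grid_box)
qed

text \<open>The Euclidean norm is estimated by the sum of the coordinates, whence the factor
  \<open>CARD('n)\<close>.\<close>

lemma dist_grid_box_le:
  fixes x y :: "real ^ 'n"
  assumes "x \<in> grid_box e k" "y \<in> grid_box e k"
  shows "dist x y \<le> 2 * e * CARD('n)"
proof -
  have "\<bar>(x - y) $ i\<bar> \<le> 2 * e" for i
  proof -
    have "\<bar>x $ i - e * k $ i\<bar> < e" "\<bar>y $ i - e * k $ i\<bar> < e"
      using assms by (simp_all add: mem_grid_box)
    then show ?thesis
      unfolding vector_minus_component by linarith
  qed
  then have "(\<Sum>i\<in>UNIV. \<bar>(x - y) $ i\<bar>) \<le> (\<Sum>i\<in>(UNIV :: 'n set). 2 * e)"
    by (intro sum_mono) auto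
  then show ?thesis
    unfolding dist_norm using norm_le_l1_cart [of "x - y"] by (simp add: mult_ac)
qed

lemma finite_card_vec_box:
  fixes A :: "'n::finite \<Rightarrow> 'b set"
  assumes "\<And>i. finite (A i)"
  shows "finite {k :: 'b ^ 'n. \<forall>i. k $ i \<in> A i}"
    and "card {k :: 'b ^ 'n. \<forall>i. k $ i \<in> A i} = (\<Prod>i\<in>UNIV. card (A i))"
proof -
  have bij: "bij_betw vec_nth {k :: 'b ^ 'n. \<forall>i. k $ i \<in> A i} (PiE UNIV A)"
    by (rule bij_betwI [where g = vec_lambda]) auto
  then show "finite {k :: 'b ^ 'n. \<forall>i. k $ i \<in> A i}"
    by (simp add: bij_betw_finite [OF bij] finite_PiE assms)
  show "card {k :: 'b ^ 'n. \<forall>i. k $ i \<in> A i} = (\<Prod>i\<in>UNIV. card (A i))"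
    using bij_betw_same_card [OF bij] by (simp add: card_PiE)
qed

text \<open>A common point forces the integer centres to differ by less than 2, hence by at most 1,
  in each coordinate, leaving three values per coordinate.\<close>

lemma card_grid_box_neighbours:
  fixes j :: "int ^ 'n"
  assumes "e > 0"
  shows "card {k \<in> I. grid_box e k \<inter> grid_box e j \<noteq> {}} \<le> 3 ^ CARD('n)"
proof -
  let ?N = "{k. \<forall>i. k $ i \<in> {j $ i - 1..j $ i + 1}}"
  have "k $ i \<in> {j $ i - 1..j $ i + 1}" if x: "x \<in> grid_box e k" "x \<in> grid_box e j" for k x i
  proof -
    have "\<bar>x $ i - e * k $ i\<bar> < e" "\<bar>x $ i - e * j $ i\<bar> < e"
      using x by (simp_all add: mem_grid_box)
    then have "\<bar>e * k $ i - e * j $ i\<bar> < e * 2"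
      by linarith
    then have "e * \<bar>real_of_int (k $ i - j $ i)\<bar> < e * 2"
      using assms by (simp add: abs_mult flip: right_diff_distrib)
    then have "\<bar>real_of_int (k $ i - j $ i)\<bar> < 2"
      using assms by simp
    then show ?thesis
      by auto
  qed
  then have "card {k \<in> I. grid_box e k \<inter> grid_box e j \<noteq> {}} \<le> card ?N"
    by (intro card_mono finite_card_vec_box(1)) fastforce+
  also have "\<dots> = 3 ^ CARD('n)"
    by (subst finite_card_vec_box(2)) auto
  finally show ?thesis .
qed

lemma grid_boxes_meeting_bounded:
  fixes Z :: "(real ^ 'n) set"
  assumes "e > 0" "Z \<subseteq> cball 0 R" "R \<ge> 0"
  defines "I \<equiv> {k. grid_box e k \<inter> Z \<noteq> {}}"
  shows "finite I" and "real (card I) \<le> (2 * R / e + 5) ^ CARD('n)"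
proof -
  \<comment> \<open>A box that meets the ball has centre coordinates of size at most
    \<open>R + e\<close>, so each \<open>k $ i\<close> has absolute value at most
    \<open>R / e + 1\<close>.\<close>
  define M where "M = \<lceil>R / e\<rceil> + 1"
  have "R / e \<ge> 0" using assms(1,3) by simp
  then have M0: "M \<ge> 0" unfolding M_def by linarith
  let ?N = "{k :: int ^ 'n. \<forall>i. k $ i \<in> {-M..M}}"
  have "k $ i \<in> {-M..M}" if x: "x \<in> grid_box e k" "x \<in> Z" for k x i
  proof -
    have "\<bar>x $ i\<bar> \<le> R"
      using x(2) assms(2) component_le_norm_cart [of x i] by (force simp: dist_norm)
    moreover have "\<bar>x $ i - e * k $ i\<bar> < e"
      using x(1) by (simp add: mem_grid_box)
    ultimately have "\<bar>e * k $ i\<bar> \<le> R + e"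
      by linarith
    then have "\<bar>real_of_int (k $ i)\<bar> \<le> R / e + 1"
      using assms(1) by (simp add: abs_mult field_simps)
    then have "\<bar>real_of_int (k $ i)\<bar> \<le> real_of_int M"
      unfolding M_def using le_of_int_ceiling [of "R / e"] by linarith
    then show ?thesis
      by (simp add: abs_le_iff)
  qed
  then have sub: "I \<subseteq> ?N"
    unfolding I_def by fastforce
  then show "finite I"
    by (rule finite_subset) (rule finite_card_vec_box(1), simp)
  have "card I \<le> card ?N"
    using sub by (intro card_mono finite_card_vec_box(1)) auto
  also have "card ?N = nat (2 * M + 1) ^ CARD('n)"
    by (subst finite_card_vec_box(2)) (auto simp: algebra_simps)
  finally have "real (card I) \<le> real (nat (2 * M + 1)) ^ CARD('n)"
    by (metis of_nat_le_iff of_nat_power)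
  also have "\<dots> \<le> (2 * R / e + 5) ^ CARD('n)"
  proof (rule power_mono)
    \<comment> \<open>There are \<open>2 * M + 1\<close> integers per coordinate, and
      \<open>2 * (R / e + 2) + 1\<close> is the bound claimed.\<close>
    have "real_of_int M \<le> R / e + 2"
      unfolding M_def using of_int_ceiling_le_add_one [of "R / e"] by linarith
    then show "real (nat (2 * M + 1)) \<le> 2 * R / e + 5"
      using M0 by simp
  qed simp
  finally show "real (card I) \<le> (2 * R / e + 5) ^ CARD('n)" .
qed

subsection \<open>The bound\<close>

lemma total_betti_unique_nearest_point_le:
  fixes Z :: "(real ^ 'n) set" and R t :: real
  assumes "compact Z" "Z \<noteq> {}" "Z \<subseteq> cball 0 R" "R \<ge> 0" "t > 0"
    and "\<And>x. infdist x Z < t \<Longrightarrow> \<exists>!z. z \<in> Z \<and> infdist x Z = dist x z"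
  shows "ennreal_of_enat (total_betti Z)
    \<le> ennreal (((8 * CARD('n) * R + 5) * (1 + 1 / t)) ^ CARD('n) * 2 ^ 3 ^ CARD('n))"
proof -
  let ?n = "CARD('n)"
  \<comment> \<open>With this mesh a box has diameter at most \<open>2 * e * ?n = t / 2\<close>, so
    every box that meets \<open>Z\<close> stays inside the tube of radius \<open>t\<close>.\<close>
  define e where "e = t / (4 * ?n)"
  define I where "I = {k :: int ^ 'n. grid_box e k \<inter> Z \<noteq> {}}"
  define K where "K = (\<Union>k\<in>I. grid_box e k)"
  have e: "e > 0" using assms(5) by (simp add: e_def)
  have finI: "finite I" and cardI: "real (card I) \<le> (2 * R / e + 5) ^ ?n"
    unfolding I_def using grid_boxes_meeting_bounded [OF e assms(3,4)] by simp_all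
  have "Z \<subseteq> K"
    using ex_grid_box [OF e] by (fastforce simp: K_def I_def)
  moreover have "K \<subseteq> {x. infdist x Z < t}"
  proof
    fix x assume "x \<in> K"
    then obtain k z where "x \<in> grid_box e k" "z \<in> grid_box e k" "z \<in> Z"
      by (auto simp: K_def I_def)
    then have "infdist x Z \<le> 2 * e * ?n"
      using dist_grid_box_le [of x e k z] infdist_le [of z Z x] by simp
    also have "\<dots> < t"
      using assms(5) by (simp add: e_def)
    finally show "x \<in> {x. infdist x Z < t}" by simp
  qed
  ultimately have "Z retract_of K"
    using nearest_point_retract [OF assms(1,2,5,6)] by (rule retract_of_subset [rotated])
  then have "total_betti Z \<le> total_betti K"
    by (rule total_betti_retract_le)
  also have "\<dots> \<le> enat (card I * 2 ^ 3 ^ ?n)"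
    unfolding K_def
    by (intro total_betti_UN_sparse_le finI card_grid_box_neighbours e) (simp_all add: grid_box_def open_box)
  finally have "ennreal_of_enat (total_betti Z) \<le> ennreal_of_enat (enat (card I * 2 ^ 3 ^ ?n))"
    by (simp only: ennreal_of_enat_le_iff)
  also have "\<dots> = ennreal (real (card I * 2 ^ 3 ^ ?n))"
    by (simp only: ennreal_of_enat_enat ennreal_of_nat_eq_real_of_nat)
  also have "\<dots> \<le> ennreal (((8 * ?n * R + 5) * (1 + 1 / t)) ^ ?n * 2 ^ 3 ^ ?n)"
  proof (rule ennreal_leI)
    \<comment> \<open>The choice of \<open>e\<close> makes the number of boxes per coordinate affine
      in \<open>1 / t\<close>; the two terms are then merged into a multiple of
      \<open>1 + 1 / t\<close>.\<close>
    have "2 * R / e + 5 = 8 * ?n * R * (1 / t) + 5"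
      using assms(5) by (simp add: e_def)
    also have "\<dots> \<le> (8 * ?n * R + 5) * (1 + 1 / t)"
      using assms(4,5) by (simp add: algebra_simps)
    finally have "(2 * R / e + 5) ^ ?n \<le> ((8 * ?n * R + 5) * (1 + 1 / t)) ^ ?n"
      using assms(4) e by (intro power_mono) auto
    with cardI have "real (card I) \<le> ((8 * ?n * R + 5) * (1 + 1 / t)) ^ ?n"
      by linarith
    then show "real (card I * 2 ^ 3 ^ ?n) \<le> ((8 * ?n * R + 5) * (1 + 1 / t)) ^ ?n * 2 ^ 3 ^ ?n"
      by simp
  qed
  finally show ?thesis .
qed

text \<open>An admissible radius above half the reach is taken, or above 1 if the reach is infinite.
  This avoids asking whether the supremum is attained, at the cost of the factor 2.\<close>

lemma reach_unique_nearest_point: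
  fixes Z :: "'a::metric_space set"
  assumes "reach Z > 0" "Z \<noteq> {}"
  obtains t where "t > 0" "\<And>x. infdist x Z < t \<Longrightarrow> \<exists>!z. z \<in> Z \<and> infdist x Z = dist x z"
    "ennreal (1 + 1 / t) \<le> 2 * (1 + 1 / reach Z)"
proof -
  have ex: "\<exists>t>0. u < ennreal t \<and> (\<forall>x. infdist x Z < t \<longrightarrow> (\<exists>!z. z \<in> Z \<and> infdist x Z = dist x z))"
    if "u < reach Z" for u
    using that assms(2) unfolding reach_def less_SUP_iff by auto
  show thesis
  proof (cases "reach Z")
    case (real \<rho>)
    then have \<rho>: "\<rho> > 0" using assms(1) by simp
    then have "ennreal (\<rho> / 2) < reach Z" using real by (simp add: ennreal_less_iff)
    then obtain t where t: "t > 0" "ennreal (\<rho> / 2) < ennreal t"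
        "\<forall>x. infdist x Z < t \<longrightarrow> (\<exists>!z. z \<in> Z \<and> infdist x Z = dist x z)"
      using ex by blast
    then have "\<rho> / 2 < t" using \<rho> by (simp add: ennreal_less_iff)
    then have "1 / t \<le> 2 / \<rho>" using \<rho> t(1) by (simp add: field_simps)
    then have "ennreal (1 + 1 / t) \<le> ennreal (2 * (1 + 1 / \<rho>))"
      by (intro ennreal_leI) simp
    also have "\<dots> = 2 * ennreal (1 + 1 / \<rho>)"
      using \<rho> by (simp only: ennreal_mult' ennreal_numeral)
    also have "ennreal (1 + 1 / \<rho>) = 1 + 1 / reach Z"
      using \<rho> unfolding real by (simp add: divide_ennreal flip: ennreal_1)
    finally show thesis using that t(1,3) by blast
  next
    \<comment> \<open>Here \<open>1 / reach Z\<close> is 0, so the right-hand side is 2.\<close>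
    case top
    then have "1 < reach Z" by simp
    then obtain t where t: "t > 0" "1 < ennreal t"
        "\<forall>x. infdist x Z < t \<longrightarrow> (\<exists>!z. z \<in> Z \<and> infdist x Z = dist x z)"
      using ex by blast
    then have "1 < t" by simp
    then have "ennreal (1 + 1 / t) \<le> ennreal 2"
      by (intro ennreal_leI) simp
    then show thesis using that t(1,3) top by simp
  qed
qed

theorem corollary9:
  fixes D :: "(real ^ 'n) set"
  assumes "\<exists>a r. r > 0 \<and> D = cball a r"
  shows "\<exists>c\<^sub>5::real. c\<^sub>5 > 0 \<and>
           (\<forall>Z. Z \<subseteq> D \<and> compact Z \<and> C1_hypersurface Z \<and> reach Z > 0 \<longrightarrow>
              ennreal_of_enat (total_betti Z) \<le> ennreal c\<^sub>5 * (1 + 1 / reach Z) ^ CARD('n))"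
proof -
  let ?n = "CARD('n)"
  obtain a r where r: "r > 0" and D: "D = cball a r" using assms by blast
  \<comment> \<open>The ball of radius \<open>R\<close> about the origin contains \<open>D\<close>,
    so the constants depend only on the disk and the dimension.\<close>
  define R where "R = norm a + r"
  define b where "b = 8 * ?n * R + 5"
  \<comment> \<open>The 2 next to \<open>b\<close> pays for replacing \<open>1 + 1 / t\<close> by
    \<open>1 + 1 / reach Z\<close>.\<close>
  define c where "c = (b * 2) ^ ?n * 2 ^ 3 ^ ?n"
  have R: "R \<ge> 0" using r by (simp add: R_def)
  then have b: "b > 0" by (simp add: b_def add_nonneg_pos)
  then have c: "c > 0" by (simp add: c_def)
  \<comment> \<open>Needed twice: with \<open>y = 1 + 1 / t\<close> to pass from the real bound to
    extended reals, and with \<open>y = 2\<close> to recognise \<open>c\<close> at the end.\<close>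
  have ennreal_eq: "ennreal ((b * y) ^ ?n * 2 ^ 3 ^ ?n) = (ennreal b * ennreal y) ^ ?n * 2 ^ 3 ^ ?n"
    if "y \<ge> 0" for y
    using b that by (simp add: ennreal_power flip: ennreal_mult ennreal_numeral)
  have "cball a r \<subseteq> cball 0 R"
    by (simp add: cball_subset_cball_iff R_def dist_norm)
  have "ennreal_of_enat (total_betti Z) \<le> ennreal c * (1 + 1 / reach Z) ^ ?n"
    if Z: "Z \<subseteq> D" "compact Z" "reach Z > 0" for Z
  proof (cases "Z = {}")
    case False
    obtain t where t: "t > 0" "\<And>x. infdist x Z < t \<Longrightarrow> \<exists>!z. z \<in> Z \<and> infdist x Z = dist x z"
        "ennreal (1 + 1 / t) \<le> 2 * (1 + 1 / reach Z)"
      using reach_unique_nearest_point [OF Z(3) False] by blast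
    have "Z \<subseteq> cball 0 R"
      using Z(1) D \<open>cball a r \<subseteq> cball 0 R\<close> by simp
    then have "ennreal_of_enat (total_betti Z) \<le> ennreal ((b * (1 + 1 / t)) ^ ?n * 2 ^ 3 ^ ?n)"
      unfolding b_def
      by (rule total_betti_unique_nearest_point_le [OF Z(2) False _ R t(1,2)])
    also have "\<dots> = (ennreal b * ennreal (1 + 1 / t)) ^ ?n * 2 ^ 3 ^ ?n"
      using t(1) by (intro ennreal_eq) simp
    also have "\<dots> \<le> (ennreal b * (2 * (1 + 1 / reach Z))) ^ ?n * 2 ^ 3 ^ ?n"
      by (intro mult_right_mono power_mono mult_left_mono t(3)) auto
    also have "\<dots> = (ennreal b * 2) ^ ?n * 2 ^ 3 ^ ?n * (1 + 1 / reach Z) ^ ?n"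
      by (simp only: power_mult_distrib mult_ac)
    also have "(ennreal b * 2) ^ ?n * 2 ^ 3 ^ ?n = ennreal c"
      unfolding c_def using ennreal_eq [of 2] by simp
    finally show ?thesis .
  qed simp
  with c show ?thesis by blast
qed

end
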